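(* The congested location problem (defined in the context) can be rewritten as the following mixed-integer second-order cone program in the variables $x=(x_{ik})$, $y=(y_{ikj})$ and real variables $r=(r_{ik})$, $t=(t_{ik})$ $(i\in I,k\in K,j\in J)$: $$\min\ \sum_{i\in I}\sum_{k\in K}f_{ik}x_{ik}+\sum_{i\in I}\sum_{k\in K}\left[\frac{w_i(1+\mu_{ik}^2\sigma_{ik}^2)\,r_{ik}}{2\mu_{ik}}+\frac{w_i\sum_{j\in J}\lambda_jy_{ikj}}{\mu_{ik}}\right]+\sum_{i\in I}\sum_{k\in K}\sum_{j\in J}d_{ij}\lambda_jy_{ikj}$$ subject to $$2\Big(\sum_{j\in J}\lambda_jy_{ikj}\Big)^2+r_{ik}^2+t_{ik}^2\le(r_{ik}+t_{ik})^2,\quad t_{ik}=\mu_{ik}-\sum_{j\in J}\lambda_jy_{ikj},\quad t_{ik}\ge0,\quad r_{ik}\ge0\qquad(i\in I,\ k\in K),$$ $$\sum_{i\in I}\sum_{k\in K}y_{ikj}=1\ (j\in J),\quad y_{ikj}\le x_{ik}\ (i\in I,k\in K,j\in J),\quad \sum_{k\in K}x_{ik}\le1\ (i\in I),\quad \sum_{j\in J}\lambda_jy_{ikj}\le\mu_{ik}\ (i\in I,k\in K),$$ $$x_{ik}\in\{0,1\}\ (i\in I,k\in K),\quad y_{ikj}\in\{0,1\}\ (i\in I,k\in K,j\in J).$$ That is, the two problems have the same optimal value, and $(x,y)$ is optimal for the congested location problem if and only if there exist $r,t$ such that $(x,y,r,t)$ is optimal for this program.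
   Context: Let $I,J,K$ be finite sets (facilities, customers, service-capacity levels). Parameters: real costs $f_{ik}$ and $d_{ij}$, demand rates $\lambda_j\ge0$, service rates $\mu_{ik}>0$, service-time standard deviations $\sigma_{ik}\ge0$, and waiting costs $w_i\ge0$ $(i\in I,j\in J,k\in K)$. The congested location problem is $$\min\ \sum_{i\in I}\sum_{k\in K}f_{ik}x_{ik}+\sum_{i\in I}\sum_{k\in K}w_i\,TW_{ik}+\sum_{i\in I}\sum_{k\in K}\sum_{j\in J}d_{ij}\lambda_jy_{ikj}$$ subject to $\sum_{i\in I}\sum_{k\in K}y_{ikj}=1$ $(j\in J)$; $y_{ikj}\le x_{ik}$ $(i\in I,k\in K,j\in J)$; $\sum_{k\in K}x_{ik}\le1$ $(i\in I)$; $\sum_{j\in J}\lambda_jy_{ikj}\le\mu_{ik}$ $(i\in I,k\in K)$; $x_{ik}\in\{0,1\}$ and $y_{ikj}\in\{0,1\}$ for all $i,k,j$; where $$TW_{ik}=\frac{\big(\sum_{j\in J}\lambda_jy_{ikj}\big)^2(1+\mu_{ik}^2\sigma_{ik}^2)}{2\mu_{ik}\big(\mu_{ik}-\sum_{j\in J}\lambda_jy_{ikj}\big)}+\frac{\sum_{j\in J}\lambda_jy_{ikj}}{\mu_{ik}}$$ is the expected total waiting at an M/G/1 facility. By the stability assumption on queues, points with $\sum_{j\in J}\lambda_jy_{ikj}=\mu_{ik}$ for some $(i,k)$ are regarded as infeasible. The optimal value of an infeasible problem is $+\infty$. *)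

theory Defs
  imports "HOL-Library.Extended_Real"
begin

record ('i, 'j, 'k) clp =
  facilities :: "'i set"
  customers :: "'j set"
  levels :: "'k set"
  fixed_cost :: "'i \<Rightarrow> 'k \<Rightarrow> real"
  travel_cost :: "'i \<Rightarrow> 'j \<Rightarrow> real"
  demand :: "'j \<Rightarrow> real"
  service_rate :: "'i \<Rightarrow> 'k \<Rightarrow> real"
  service_sd :: "'i \<Rightarrow> 'k \<Rightarrow> real"
  waiting_cost :: "'i \<Rightarrow> real"

(* Decision variables are total functions; their values at indices outside the
   index sets of the instance occur in no constraint and no objective. *)

type_synonym ('i, 'k) open_var = "'i \<Rightarrow> 'k \<Rightarrow> real"
type_synonym ('i, 'k, 'j) assign_var = "'i \<Rightarrow> 'k \<Rightarrow> 'j \<Rightarrow> real"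

definition arrival_rate ::
  "('i, 'j, 'k) clp \<Rightarrow> ('i, 'k, 'j) assign_var \<Rightarrow> 'i \<Rightarrow> 'k \<Rightarrow> real" where
  "arrival_rate P y i k = (\<Sum>j\<in>customers P. demand P j * y i k j)"

definition total_waiting ::
  "('i, 'j, 'k) clp \<Rightarrow> ('i, 'k, 'j) assign_var \<Rightarrow> 'i \<Rightarrow> 'k \<Rightarrow> real" where
  "total_waiting P y i k =
     (arrival_rate P y i k)\<^sup>2 * (1 + (service_rate P i k)\<^sup>2 * (service_sd P i k)\<^sup>2) /
       (2 * service_rate P i k * (service_rate P i k - arrival_rate P y i k))
     + arrival_rate P y i k / service_rate P i k"

definition location_constraints ::
  "('i, 'j, 'k) clp \<Rightarrow> ('i, 'k) open_var \<Rightarrow> ('i, 'k, 'j) assign_var \<Rightarrow> bool" where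
  "location_constraints P x y \<longleftrightarrow>
     (\<forall>j\<in>customers P. (\<Sum>i\<in>facilities P. \<Sum>k\<in>levels P. y i k j) = 1) \<and>
     (\<forall>i\<in>facilities P. \<forall>k\<in>levels P. \<forall>j\<in>customers P. y i k j \<le> x i k) \<and>
     (\<forall>i\<in>facilities P. (\<Sum>k\<in>levels P. x i k) \<le> 1) \<and>
     (\<forall>i\<in>facilities P. \<forall>k\<in>levels P. arrival_rate P y i k \<le> service_rate P i k) \<and>
     (\<forall>i\<in>facilities P. \<forall>k\<in>levels P. x i k \<in> {0, 1}) \<and>
     (\<forall>i\<in>facilities P. \<forall>k\<in>levels P. \<forall>j\<in>customers P. y i k j \<in> {0, 1})"

(* The last conjunct is the queue stability assumption; it also keeps the
   denominator in total_waiting nonzero. *)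

definition clp_feasible ::
  "('i, 'j, 'k) clp \<Rightarrow> ('i, 'k) open_var \<times> ('i, 'k, 'j) assign_var \<Rightarrow> bool" where
  "clp_feasible P = (\<lambda>(x, y).
     location_constraints P x y \<and>
     (\<forall>i\<in>facilities P. \<forall>k\<in>levels P. arrival_rate P y i k \<noteq> service_rate P i k))"

definition clp_objective ::
  "('i, 'j, 'k) clp \<Rightarrow> ('i, 'k) open_var \<times> ('i, 'k, 'j) assign_var \<Rightarrow> real" where
  "clp_objective P = (\<lambda>(x, y).
     (\<Sum>i\<in>facilities P. \<Sum>k\<in>levels P. fixed_cost P i k * x i k)
     + (\<Sum>i\<in>facilities P. \<Sum>k\<in>levels P. waiting_cost P i * total_waiting P y i k)
     + (\<Sum>i\<in>facilities P. \<Sum>k\<in>levels P. \<Sum>j\<in>customers P.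
          travel_cost P i j * demand P j * y i k j))"

definition misocp_feasible ::
  "('i, 'j, 'k) clp \<Rightarrow>
   ('i, 'k) open_var \<times> ('i, 'k, 'j) assign_var \<times> ('i \<Rightarrow> 'k \<Rightarrow> real) \<times> ('i \<Rightarrow> 'k \<Rightarrow> real) \<Rightarrow> bool"
  where
  "misocp_feasible P = (\<lambda>(x, y, r, t).
     (\<forall>i\<in>facilities P. \<forall>k\<in>levels P.
        2 * (arrival_rate P y i k)\<^sup>2 + (r i k)\<^sup>2 + (t i k)\<^sup>2 \<le> (r i k + t i k)\<^sup>2 \<and>
        t i k = service_rate P i k - arrival_rate P y i k \<and>
        t i k \<ge> 0 \<and> r i k \<ge> 0) \<and>
     location_constraints P x y)"

definition misocp_objective ::
  "('i, 'j, 'k) clp \<Rightarrow>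
   ('i, 'k) open_var \<times> ('i, 'k, 'j) assign_var \<times> ('i \<Rightarrow> 'k \<Rightarrow> real) \<times> ('i \<Rightarrow> 'k \<Rightarrow> real) \<Rightarrow> real"
  where
  "misocp_objective P = (\<lambda>(x, y, r, t).
     (\<Sum>i\<in>facilities P. \<Sum>k\<in>levels P. fixed_cost P i k * x i k)
     + (\<Sum>i\<in>facilities P. \<Sum>k\<in>levels P.
          waiting_cost P i * (1 + (service_rate P i k)\<^sup>2 * (service_sd P i k)\<^sup>2) * r i k /
            (2 * service_rate P i k)
          + waiting_cost P i * arrival_rate P y i k / service_rate P i k)
     + (\<Sum>i\<in>facilities P. \<Sum>k\<in>levels P. \<Sum>j\<in>customers P.
          travel_cost P i j * demand P j * y i k j))"

(* The infimum of the empty set in ereal is the value +infinity required for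
   infeasible problems. *)

definition optimal_value :: "('a \<Rightarrow> real) \<Rightarrow> ('a \<Rightarrow> bool) \<Rightarrow> ereal" where
  "optimal_value obj feasible = (INF z \<in> {z. feasible z}. ereal (obj z))"

end

(* With a the arrival rate, the cone constraint 2 a^2 + r^2 + t^2 \<le> (r + t)^2 says a^2 \<le> r t.
   As t = mu - a, it is violated when t = 0 (then a = mu > 0), so it enforces stability, and
   otherwise it bounds r below by a^2 / t.  The second objective is nondecreasing in r and equals
   the first one at r = a^2 / t, so minimising out (r, t) returns the location problem. *)

theory Submission
  imports Defs
begin

text \<open>Each infimum bounds the other, since \<open>p b\<close> costs at most as much as
  \<open>b\<close> and \<open>s a\<close> costs the same as \<open>a\<close>. Nothing has to be
  attained, so infeasible and unattained problems are covered.\<close>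

lemma optimal_value_eq_of_lift:
  assumes proj: "\<And>b. feasB b \<Longrightarrow> feasA (p b) \<and> objA (p b) \<le> objB b"
    and lift: "\<And>a. feasA a \<Longrightarrow> feasB (s a) \<and> objB (s a) = objA a"
  shows "optimal_value objA feasA = optimal_value objB feasB"
proof (rule antisym)
  show "optimal_value objA feasA \<le> optimal_value objB feasB"
    unfolding optimal_value_def
    by (rule INF_mono) (use proj in auto)
  show "optimal_value objB feasB \<le> optimal_value objA feasA"
    unfolding optimal_value_def
    by (rule INF_mono) (metis lift mem_Collect_eq order_refl)
qed

text \<open>Forward, \<open>s a\<close> is the minimiser: it costs \<open>objA a\<close>, which by
  projection is a lower bound for \<open>objB\<close>. Backward, the chain is
  \<open>objA (p b)\<close> \<le> \<open>objB b\<close> \<le> \<open>objB (s z)\<close> =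
  \<open>objA z\<close>. The equation \<open>p (s a) = a\<close> makes \<open>s a\<close> a witness
  over \<open>a\<close>.\<close>

lemma is_arg_min_iff_of_lift:
  fixes objA :: "'a \<Rightarrow> 'c::linorder"
  assumes proj: "\<And>b. feasB b \<Longrightarrow> feasA (p b) \<and> objA (p b) \<le> objB b"
    and lift: "\<And>a. feasA a \<Longrightarrow> feasB (s a) \<and> p (s a) = a \<and> objB (s a) = objA a"
  shows "is_arg_min objA feasA a \<longleftrightarrow> (\<exists>b. p b = a \<and> is_arg_min objB feasB b)"
proof
  assume "is_arg_min objA feasA a"
  then have a: "feasA a" and min: "\<And>z. feasA z \<Longrightarrow> objA a \<le> objA z"
    by (auto simp: is_arg_min_linorder)
  have "is_arg_min objB feasB (s a)"
    unfolding is_arg_min_linorder using lift[OF a] min proj by (metis order_trans)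
  with lift[OF a] show "\<exists>b. p b = a \<and> is_arg_min objB feasB b" by blast
next
  assume "\<exists>b. p b = a \<and> is_arg_min objB feasB b"
  then obtain b where b: "p b = a" "feasB b" and min: "\<And>z. feasB z \<Longrightarrow> objB b \<le> objB z"
    by (auto simp: is_arg_min_linorder)
  have "objA a \<le> objA z" if "feasA z" for z
    using proj[OF b(2)] min[of "s z"] lift[OF that] b(1) by (metis order_trans)
  then show "is_arg_min objA feasA a"
    using proj[OF b(2)] b(1) by (auto simp: is_arg_min_linorder)
qed

lemma cone_constraint_iff:
  fixes a r t :: real
  shows "2 * a\<^sup>2 + r\<^sup>2 + t\<^sup>2 \<le> (r + t)\<^sup>2 \<longleftrightarrow> a\<^sup>2 \<le> r * t"
  by (simp add: power2_sum)

definition slack_rate ::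
  "('i, 'j, 'k) clp \<Rightarrow> ('i, 'k, 'j) assign_var \<Rightarrow> 'i \<Rightarrow> 'k \<Rightarrow> real" where
  "slack_rate P y i k = service_rate P i k - arrival_rate P y i k"

text \<open>The least r that the cone constraint admits when t is a positive slack.\<close>

definition congestion ::
  "('i, 'j, 'k) clp \<Rightarrow> ('i, 'k, 'j) assign_var \<Rightarrow> 'i \<Rightarrow> 'k \<Rightarrow> real" where
  "congestion P y i k = (arrival_rate P y i k)\<^sup>2 / slack_rate P y i k"

text \<open>Both waiting terms are quotients with the same denominator, so they agree even at zero
  slack, where division by zero gives 0 on both sides. The objective does not read t, hence t is
  arbitrary.\<close>

lemma misocp_objective_congestion:
  "misocp_objective P (x, y, congestion P y, t) = clp_objective P (x, y)"
proof -
  have "waiting_cost P i * (1 + (service_rate P i k)\<^sup>2 * (service_sd P i k)\<^sup>2) * congestion P y i k /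
          (2 * service_rate P i k)
        + waiting_cost P i * arrival_rate P y i k / service_rate P i k
      = waiting_cost P i * total_waiting P y i k" for i k
    by (simp add: congestion_def slack_rate_def total_waiting_def distrib_left add_divide_distrib mult_ac)
  then show ?thesis
    by (simp add: misocp_objective_def clp_objective_def)
qed

text \<open>The coefficient of \<open>r i k\<close> is w (1 + mu^2 sigma^2) / (2 mu), which is
  nonnegative.\<close>

lemma misocp_objective_mono:
  assumes "\<forall>i\<in>facilities P. \<forall>k\<in>levels P. service_rate P i k > 0"
    and "\<forall>i\<in>facilities P. waiting_cost P i \<ge> 0"
    and "\<forall>i\<in>facilities P. \<forall>k\<in>levels P. r i k \<le> r' i k"
  shows "misocp_objective P (x, y, r, t) \<le> misocp_objective P (x, y, r', t')"
  unfolding misocp_objective_def prod.case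
  using assms
  by (intro add_mono sum_mono order_refl divide_right_mono mult_left_mono) (auto simp: less_imp_le)

lemma misocp_feasible_lift:
  assumes "clp_feasible P (x, y)"
  shows "misocp_feasible P (x, y, congestion P y, slack_rate P y)"
proof -
  \<comment> \<open>Capacity gives \<le> and stability excludes equality. With positive slack, the
    cone constraint then holds with equality.\<close>
  have "slack_rate P y i k > 0" if "i \<in> facilities P" "k \<in> levels P" for i k
    using assms that
    by (force simp: clp_feasible_def location_constraints_def slack_rate_def less_le)
  then have "(arrival_rate P y i k)\<^sup>2 \<le> congestion P y i k * slack_rate P y i k
      \<and> slack_rate P y i k \<ge> 0 \<and> congestion P y i k \<ge> 0"
    if "i \<in> facilities P" "k \<in> levels P" for i k
    using that by (simp add: congestion_def less_imp_le less_imp_neq[symmetric])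
  then show ?thesis
    using assms
    by (simp add: misocp_feasible_def clp_feasible_def cone_constraint_iff) (simp add: slack_rate_def)
qed

text \<open>Both bounds come from a^2 \<le> r t. If t = 0, this forces a = 0, against a = mu > 0; so
  t > 0, and dividing by t bounds r.\<close>

lemma misocp_feasible_bounds:
  assumes "misocp_feasible P (x, y, r, t)"
    and "i \<in> facilities P" "k \<in> levels P" "service_rate P i k > 0"
  shows "slack_rate P y i k > 0" and "congestion P y i k \<le> r i k"
proof -
  have *: "(arrival_rate P y i k)\<^sup>2 \<le> r i k * t i k" "t i k = slack_rate P y i k" "t i k \<ge> 0"
    using assms(1-3) unfolding misocp_feasible_def cone_constraint_iff slack_rate_def by blast+
  have "t i k \<noteq> 0"
    using * assms(4) by (auto simp: slack_rate_def)
  with * show pos: "slack_rate P y i k > 0" by simp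
  show "congestion P y i k \<le> r i k"
    using * pos by (simp add: congestion_def pos_divide_le_eq)
qed

lemma clp_feasible_of_misocp:
  assumes "\<forall>i\<in>facilities P. \<forall>k\<in>levels P. service_rate P i k > 0"
    and "misocp_feasible P (x, y, r, t)"
  shows "clp_feasible P (x, y)"
  using assms misocp_feasible_bounds(1)[OF assms(2)]
  by (fastforce simp: clp_feasible_def misocp_feasible_def slack_rate_def)

theorem mainTheorem3:
  fixes P :: "('i, 'j, 'k) clp"
  assumes "finite (facilities P)" and "finite (customers P)" and "finite (levels P)"
    and "\<forall>j\<in>customers P. demand P j \<ge> 0"
    and "\<forall>i\<in>facilities P. \<forall>k\<in>levels P. service_rate P i k > 0"
    and "\<forall>i\<in>facilities P. \<forall>k\<in>levels P. service_sd P i k \<ge> 0"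
    and "\<forall>i\<in>facilities P. waiting_cost P i \<ge> 0"
  shows "optimal_value (clp_objective P) (clp_feasible P)
           = optimal_value (misocp_objective P) (misocp_feasible P)
         \<and> (\<forall>x y. is_arg_min (clp_objective P) (clp_feasible P) (x, y)
              \<longleftrightarrow> (\<exists>r t. is_arg_min (misocp_objective P) (misocp_feasible P) (x, y, r, t)))"
proof -
  \<comment> \<open>\<open>p\<close> forgets (r, t); \<open>s\<close> restores the forced t and the
    cheapest r.\<close>
  define p :: "('i, 'k) open_var \<times> ('i, 'k, 'j) assign_var \<times> ('i \<Rightarrow> 'k \<Rightarrow> real) \<times> ('i \<Rightarrow> 'k \<Rightarrow> real)
      \<Rightarrow> ('i, 'k) open_var \<times> ('i, 'k, 'j) assign_var" where "p = (\<lambda>(x, y, r, t). (x, y))"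
  define s where "s = (\<lambda>(x :: ('i, 'k) open_var, y). (x, y, congestion P y, slack_rate P y))"
  have proj: "clp_feasible P (p b) \<and> clp_objective P (p b) \<le> misocp_objective P b"
    if feas: "misocp_feasible P b" for b
  proof -
    obtain x y r t where b: "b = (x, y, r, t)" by (cases b)
    have "clp_feasible P (x, y)"
      using clp_feasible_of_misocp assms(5) feas b by blast
    moreover have "clp_objective P (x, y) \<le> misocp_objective P (x, y, r, t)"
      \<comment> \<open>Reading the left side as the cone program's objective at r =
        \<open>congestion P y\<close> reduces the comparison to monotonicity in r.\<close>
      unfolding misocp_objective_congestion[of P x y t, symmetric]
      using assms(5,7) misocp_feasible_bounds(2)[OF feas[unfolded b]]
      by (intro misocp_objective_mono) auto
    ultimately show ?thesis by (simp add: b p_def)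
  qed
  have lift: "misocp_feasible P (s a) \<and> p (s a) = a \<and> misocp_objective P (s a) = clp_objective P a"
    if "clp_feasible P a" for a
    using that
    by (cases a) (simp add: s_def p_def misocp_feasible_lift misocp_objective_congestion)
  have "optimal_value (clp_objective P) (clp_feasible P)
      = optimal_value (misocp_objective P) (misocp_feasible P)"
    using proj lift by (intro optimal_value_eq_of_lift[where p = p and s = s]) auto
  moreover have "is_arg_min (clp_objective P) (clp_feasible P) (x, y)
      \<longleftrightarrow> (\<exists>r t. is_arg_min (misocp_objective P) (misocp_feasible P) (x, y, r, t))" for x y
    \<comment> \<open>A point \<open>b\<close> with \<open>p b = (x, y)\<close> is exactly a choice
      of r and t.\<close>
    using is_arg_min_iff_of_lift[where p = p and s = s and a = "(x, y)",
        of "misocp_feasible P" "clp_feasible P" "clp_objective P" "misocp_objective P"] proj lift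
    by (auto simp: p_def)
  ultimately show ?thesis by blast
qed

end
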